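(* Let $n\geq 3$. Every $n$-dimensional non-abelian algebra over $\mathbb{C}$ degenerates to at least one of the following algebras: $$p_n^{-}, \qquad n_3^{-} \oplus a_{n-3}, \qquad \lambda_2 \oplus a_{n-2}, \qquad \nu_n(\alpha) \ \text{ for some } \alpha\in \mathbb{C}.$$
   Context: An $n$-dimensional algebra over $\mathbb{C}$ is an $n$-dimensional complex vector space $V$ with an arbitrary bilinear map $\lambda: V\times V\to V$ (no identities such as associativity, commutativity or existence of a unit are assumed), i.e. a point $\lambda$ of the $n^3$-dimensional affine space $\mathrm{Hom}(V\otimes V,V)$. It is abelian if its multiplication is zero. The group $GL_n(\mathbb{C})=GL(V)$ acts by $(g*\lambda)(x,y)=g(\lambda(g^{-1}(x),g^{-1}(y)))$; the orbit $Orb(\lambda)$ is the isomorphism class of $\lambda$. For $n$-dimensional complex algebras $\lambda,\mu$, we say $\lambda$ degenerates to $\mu$, written $\lambda\to\mu$, if $Orb(\mu)$ lies in the Zariski closure of $Orb(\lambda)$ in $\mathrm{Hom}(V\otimes V,V)$. Notation (all products of basis vectors not listed are zero; $\oplus$ is the direct sum of algebras; $a_m$ is the $m$-dimensional algebra with zero multiplication, with $a_0=0$): - $p_n^{-}$: basis $e_1,\dots,e_n$, with $e_1e_i=e_i$, $e_ie_1=-e_i$ for $2\le i\le n$. - $n_3^{-}$: basis $e_1,e_2,e_3$, with $e_1e_2=e_3$, $e_2e_1=-e_3$. - $\lambda_2$: basis $e_1,e_2$, with $e_1e_1=e_2$. - $\nu_n(\alpha)$: basis $e_1,\dots,e_n$,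 with $e_1e_1=e_1$, $e_1e_i=\alpha e_i$, $e_ie_1=(1-\alpha)e_i$ for $2\le i\le n$. *)

theory Defs
  imports Complex_Main "HOL-Library.FuncSet" "Jordan_Normal_Form.Matrix"
begin

text \<open>
  The underlying vector space of an n-dimensional algebra is \<^term>\<open>carrier_vec n :: complex vec set\<close>.
  A multiplication is a curried function that is extensional on this carrier, so that equality of
  functions is equality of bilinear maps and \<open>algs n\<close> is in bijection with \<open>Hom(V \<otimes> V, V)\<close>.
\<close>

type_synonym mult = "complex vec \<Rightarrow> complex vec \<Rightarrow> complex vec"

definition algs :: "nat \<Rightarrow> mult set" where
  "algs n = {l \<in> carrier_vec n \<rightarrow>\<^sub>E carrier_vec n \<rightarrow>\<^sub>E carrier_vec n.
     (\<forall>x\<in>carrier_vec n. \<forall>y\<in>carrier_vec n. \<forall>z\<in>carrier_vec n. \<forall>c.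
        l (x + y) z = l x z + l y z \<and> l z (x + y) = l z x + l z y \<and>
        l (c \<cdot>\<^sub>v x) y = c \<cdot>\<^sub>v l x y \<and> l x (c \<cdot>\<^sub>v y) = c \<cdot>\<^sub>v l x y)}"

definition abelian :: "nat \<Rightarrow> mult \<Rightarrow> bool" where
  "abelian n l \<longleftrightarrow> (\<forall>x\<in>carrier_vec n. \<forall>y\<in>carrier_vec n. l x y = 0\<^sub>v n)"

abbreviation GL :: "nat \<Rightarrow> complex mat set" where
  "GL n \<equiv> Units (ring_mat TYPE(complex) n ())"

abbreviation GL_inv :: "nat \<Rightarrow> complex mat \<Rightarrow> complex mat" where
  "GL_inv n g \<equiv> m_inv (ring_mat TYPE(complex) n ()) g"

definition act :: "nat \<Rightarrow> complex mat \<Rightarrow> mult \<Rightarrow> mult" where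
  "act n g l = (\<lambda>x\<in>carrier_vec n. \<lambda>y\<in>carrier_vec n.
     g *\<^sub>v l (GL_inv n g *\<^sub>v x) (GL_inv n g *\<^sub>v y))"

definition Orb :: "nat \<Rightarrow> mult \<Rightarrow> mult set" where
  "Orb n l = {act n g l | g. g \<in> GL n}"

text \<open>
  Polynomial functions on the affine space \<open>algs n\<close>, whose \<open>n\<^sup>3\<close> coordinates are the structure
  constants with respect to the standard basis.
\<close>

inductive_set poly_funs :: "nat \<Rightarrow> (mult \<Rightarrow> complex) set" for n where
  const: "(\<lambda>_. c) \<in> poly_funs n"
| coord: "\<lbrakk>i < n; j < n; k < n\<rbrakk> \<Longrightarrow> (\<lambda>l. l (unit_vec n i) (unit_vec n j) $ k) \<in> poly_funs n"
| add: "\<lbrakk>p \<in> poly_funs n; q \<in> poly_funs n\<rbrakk> \<Longrightarrow> (\<lambda>l. p l + q l) \<in> poly_funs n"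
| mult: "\<lbrakk>p \<in> poly_funs n; q \<in> poly_funs n\<rbrakk> \<Longrightarrow> (\<lambda>l. p l * q l) \<in> poly_funs n"

definition zariski_closed :: "nat \<Rightarrow> mult set \<Rightarrow> bool" where
  "zariski_closed n Z \<longleftrightarrow> (\<exists>P \<subseteq> poly_funs n. Z = {l \<in> algs n. \<forall>p\<in>P. p l = 0})"

definition zariski_closure :: "nat \<Rightarrow> mult set \<Rightarrow> mult set" where
  "zariski_closure n S = zariski_closed n hull S"

definition degenerates :: "nat \<Rightarrow> mult \<Rightarrow> mult \<Rightarrow> bool" where
  "degenerates n l m \<longleftrightarrow> Orb n m \<subseteq> zariski_closure n (Orb n l)"

text \<open>
  \<open>table_alg n T\<close> is the bilinear extension of the multiplication table \<open>T i j = e\<^sub>i e\<^sub>j\<close>.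
  Basis vectors are numbered from 1 in tables, whereas vector entries are numbered from 0.
\<close>

definition bvec :: "nat \<Rightarrow> nat \<Rightarrow> complex vec" where
  "bvec n i = unit_vec n (i - 1)"

definition table_alg :: "nat \<Rightarrow> (nat \<Rightarrow> nat \<Rightarrow> complex vec) \<Rightarrow> mult" where
  "table_alg n T = (\<lambda>x\<in>carrier_vec n. \<lambda>y\<in>carrier_vec n.
     vec n (\<lambda>k. \<Sum>i=1..n. \<Sum>j=1..n. x $ (i - 1) * y $ (j - 1) * T i j $ k))"

definition alg_sum :: "nat \<Rightarrow> nat \<Rightarrow> mult \<Rightarrow> mult \<Rightarrow> mult" where
  "alg_sum m k l l' = (\<lambda>x\<in>carrier_vec (m + k). \<lambda>y\<in>carrier_vec (m + k).
     l (vec_first x m) (vec_first y m) @\<^sub>v l' (vec_last x k) (vec_last y k))"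

definition zero_alg :: "nat \<Rightarrow> mult" where
  "zero_alg m = (\<lambda>x\<in>carrier_vec m. \<lambda>y\<in>carrier_vec m. 0\<^sub>v m)"

definition p_minus :: "nat \<Rightarrow> mult" where
  "p_minus n = table_alg n (\<lambda>i j.
     if i = 1 \<and> 2 \<le> j then bvec n j
     else if 2 \<le> i \<and> j = 1 then - bvec n i
     else 0\<^sub>v n)"

definition n3_minus :: mult where
  "n3_minus = table_alg 3 (\<lambda>i j.
     if i = 1 \<and> j = 2 then bvec 3 3
     else if i = 2 \<and> j = 1 then - bvec 3 3
     else 0\<^sub>v 3)"

definition lambda2 :: mult where
  "lambda2 = table_alg 2 (\<lambda>i j. if i = 1 \<and> j = 1 then bvec 2 2 else 0\<^sub>v 2)"

definition nu :: "nat \<Rightarrow> complex \<Rightarrow> mult" where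
  "nu n \<alpha> = table_alg n (\<lambda>i j.
     if i = 1 \<and> j = 1 then bvec n 1
     else if i = 1 \<and> 2 \<le> j then \<alpha> \<cdot>\<^sub>v bvec n j
     else if 2 \<le> i \<and> j = 1 then (1 - \<alpha>) \<cdot>\<^sub>v bvec n i
     else 0\<^sub>v n)"

text \<open>
  \<open>zariski_closure n S\<close> is meaningful only for \<open>S \<subseteq> algs n\<close>. The following facts show that orbits
  and all the algebras above lie in the respective \<open>algs n\<close>, and that tables multiply basis vectors
  as prescribed.
\<close>

lemma algs_restrictI:
  assumes "\<And>x y. \<lbrakk>x \<in> carrier_vec n; y \<in> carrier_vec n\<rbrakk> \<Longrightarrow> f x y \<in> carrier_vec n"
    and "\<And>x y z. \<lbrakk>x \<in> carrier_vec n; y \<in> carrier_vec n; z \<in> carrier_vec n\<rbrakk> \<Longrightarrow> f (x + y) z = f x z + f y z"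
    and "\<And>x y z. \<lbrakk>x \<in> carrier_vec n; y \<in> carrier_vec n; z \<in> carrier_vec n\<rbrakk> \<Longrightarrow> f z (x + y) = f z x + f z y"
    and "\<And>x y c. \<lbrakk>x \<in> carrier_vec n; y \<in> carrier_vec n\<rbrakk> \<Longrightarrow> f (c \<cdot>\<^sub>v x) y = c \<cdot>\<^sub>v f x y"
    and "\<And>x y c. \<lbrakk>x \<in> carrier_vec n; y \<in> carrier_vec n\<rbrakk> \<Longrightarrow> f x (c \<cdot>\<^sub>v y) = c \<cdot>\<^sub>v f x y"
  shows "(\<lambda>x\<in>carrier_vec n. \<lambda>y\<in>carrier_vec n. f x y) \<in> algs n"
  using assms unfolding algs_def by (auto intro!: restrict_PiE_iff[THEN iffD2])

lemma algsD:
  assumes "l \<in> algs n" "x \<in> carrier_vec n" "y \<in> carrier_vec n"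
  shows "l x y \<in> carrier_vec n"
    "z \<in> carrier_vec n \<Longrightarrow> l (x + y) z = l x z + l y z"
    "z \<in> carrier_vec n \<Longrightarrow> l z (x + y) = l z x + l z y"
    "l (c \<cdot>\<^sub>v x) y = c \<cdot>\<^sub>v l x y"
    "l x (c \<cdot>\<^sub>v y) = c \<cdot>\<^sub>v l x y"
  using assms unfolding algs_def by (auto dest: PiE_mem)

lemma act_in_algs:
  assumes l: "l \<in> algs n" and g: "g \<in> GL n"
  shows "act n g l \<in> algs n"
proof -
  interpret R: ring "ring_mat TYPE(complex) n ()" by (rule ring_mat)
  have gc: "g \<in> carrier_mat n n" using R.Units_closed[OF g] by (simp add: ring_mat_simps)
  have hc: "GL_inv n g \<in> carrier_mat n n" using R.Units_inv_closed[OF g] by (simp add: ring_mat_simps)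
  note c = mult_mat_vec_carrier[OF hc]
  show ?thesis unfolding act_def
    by (rule algs_restrictI)
      (auto simp: mult_add_distrib_mat_vec[OF hc] mult_add_distrib_mat_vec[OF gc] mult_mat_vec[OF hc]
        mult_mat_vec[OF gc] algsD[OF l] c intro!: mult_mat_vec_carrier[OF gc])
qed

lemma Orb_subset_algs: "l \<in> algs n \<Longrightarrow> Orb n l \<subseteq> algs n"
  by (auto simp: Orb_def act_in_algs)

lemma table_alg_in_algs: "table_alg n T \<in> algs n"
  unfolding table_alg_def
  by (rule algs_restrictI)
    (auto intro!: eq_vecI sum.cong simp: sum.distrib[symmetric] sum_distrib_left algebra_simps)

lemma table_alg_basis:
  assumes "i \<in> {1..n}" "j \<in> {1..n}" "T i j \<in> carrier_vec n"
  shows "table_alg n T (bvec n i) (bvec n j) = T i j"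
proof (rule eq_vecI)
  fix k assume k: "k < dim_vec (T i j)"
  have "(\<Sum>i'=1..n. \<Sum>j'=1..n. bvec n i $ (i' - 1) * bvec n j $ (j' - 1) * T i' j' $ k)
      = (\<Sum>i'=1..n. \<Sum>j'=1..n. if i' = i then (if j' = j then T i j $ k else 0) else 0)"
    using assms by (intro sum.cong refl) (auto simp: bvec_def eq_diff_iff)
  also have "\<dots> = (\<Sum>i'=1..n. if i' = i then (\<Sum>j'=1..n. if j' = j then T i j $ k else 0) else 0)"
    by (intro sum.cong refl) auto
  also have "\<dots> = T i j $ k" using assms(1,2) by simp
  finally show "table_alg n T (bvec n i) (bvec n j) $ k = T i j $ k"
    using k assms(3) by (simp add: table_alg_def) (simp add: bvec_def)
qed (use assms in \<open>auto simp: table_alg_def bvec_def\<close>)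

lemma zero_alg_in_algs: "zero_alg n \<in> algs n"
  unfolding zero_alg_def by (rule algs_restrictI) auto

lemma alg_sum_in_algs:
  assumes "l \<in> algs m" "l' \<in> algs k"
  shows "alg_sum m k l l' \<in> algs (m + k)"
proof -
  have f: "vec_first (x + y) m = vec_first x m + vec_first y m"
    "vec_first (c \<cdot>\<^sub>v x) m = c \<cdot>\<^sub>v vec_first x m"
    "vec_last (x + y) k = vec_last x k + vec_last y k"
    "vec_last (c \<cdot>\<^sub>v x) k = c \<cdot>\<^sub>v vec_last x k"
    if "x \<in> carrier_vec (m + k)" "y \<in> carrier_vec (m + k)" for x y :: "complex vec" and c
    using that by (auto simp: vec_first_def vec_last_def)
  have s: "c \<cdot>\<^sub>v (x @\<^sub>v y) = c \<cdot>\<^sub>v x @\<^sub>v c \<cdot>\<^sub>v y" for x y :: "complex vec" and c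
    by (rule eq_vecI) auto
  show ?thesis unfolding alg_sum_def
    by (rule algs_restrictI)
      (auto simp: f s algsD[OF assms(1)] algsD[OF assms(2)]
        intro!: append_carrier_vec append_vec_add[of _ m _ _ k, symmetric])
qed

end

theory Submission
  imports Defs "Jordan_Normal_Form.Determinant"
begin

text \<open>
  Changing the basis and rescaling its vectors by powers of a parameter \<open>t \<rightarrow> 0\<close> kills all
  structure constants of positive weight. If some \<open>x\<close> and \<open>x\<^sup>2\<close> are independent, take
  \<open>e\<^sub>1 = x\<close>, \<open>e\<^sub>2 = x\<^sup>2\<close> with weights \<open>(1, 2, \<dots>, 2)\<close>: only \<open>\<lambda>\<^sub>2\<close> survives. Otherwise, if some
  \<open>xy\<close> is outside the span of \<open>x, y\<close>, the basis \<open>x, y, xy, \<dots>\<close> with weights \<open>(1, 1, 2, \<dots>, 2)\<close> leads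
  to \<open>n\<^sub>3\<^sup>-\<close>. In the remaining case every product lies in the span of its factors, so that
  modulo \<open>e\<^sub>1\<close> left and right multiplication by \<open>e\<^sub>1\<close> are scalars \<open>a, b\<close> with
  \<open>e\<^sub>1e\<^sub>1 = (a + b) e\<^sub>1\<close>. A suitable \<open>e\<^sub>1\<close> has \<open>a + b = 1\<close> or \<open>a = 1, b = -1\<close>, and the weights
  \<open>(0, 1, \<dots>, 1)\<close> lead to \<open>\<nu>\<^sub>n(a)\<close> or \<open>p\<^sub>n\<^sup>-\<close>.
\<close>

section \<open>The action of the general linear group on multiplications\<close>

lemma GL_carrier:
  assumes "g \<in> GL n"
  shows "g \<in> carrier_mat n n" "GL_inv n g \<in> carrier_mat n n" "GL_inv n g \<in> GL n"
proof -
  interpret R: ring "ring_mat TYPE(complex) n ()" by (rule ring_mat)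
  show "g \<in> carrier_mat n n" "GL_inv n g \<in> carrier_mat n n" "GL_inv n g \<in> GL n"
    using R.Units_closed[OF assms] R.Units_inv_closed[OF assms] R.Units_inv_Units[OF assms]
    by (simp_all add: ring_mat_simps)
qed

lemma GL_mult:
  assumes "g \<in> GL n" "h \<in> GL n"
  shows "g * h \<in> GL n"
proof -
  interpret R: ring "ring_mat TYPE(complex) n ()" by (rule ring_mat)
  show ?thesis using R.Units_m_closed[OF assms] by (simp add: ring_mat_simps)
qed

lemma GL_inv_cancel:
  assumes "g \<in> GL n" "x \<in> carrier_vec n"
  shows "GL_inv n g *\<^sub>v (g *\<^sub>v x) = x" "g *\<^sub>v (GL_inv n g *\<^sub>v x) = x"
proof -
  interpret R: ring "ring_mat TYPE(complex) n ()" by (rule ring_mat)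
  note g = GL_carrier[OF assms(1)]
  have "GL_inv n g * g = 1\<^sub>m n" "g * GL_inv n g = 1\<^sub>m n"
    using R.Units_l_inv[OF assms(1)] R.Units_r_inv[OF assms(1)] by (simp_all add: ring_mat_simps)
  then show "GL_inv n g *\<^sub>v (g *\<^sub>v x) = x" "g *\<^sub>v (GL_inv n g *\<^sub>v x) = x"
    using assoc_mult_mat_vec[OF g(2,1) assms(2)] assoc_mult_mat_vec[OF g(1,2) assms(2)] assms(2)
    by simp_all
qed

text \<open>A trivial kernel forces a nonzero determinant over a field.\<close>

lemma GL_I:
  assumes A: "A \<in> carrier_mat n n"
    and inj: "\<And>w. w \<in> carrier_vec n \<Longrightarrow> A *\<^sub>v w = 0\<^sub>v n \<Longrightarrow> w = 0\<^sub>v n"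
  shows "A \<in> GL n"
proof (rule det_non_zero_imp_unit[OF A])
  show "det A \<noteq> 0"
    unfolding det_0_iff_vec_prod_zero_field[OF A] using inj by auto
qed

lemma act_apply:
  assumes "g \<in> GL n" "x \<in> carrier_vec n" "y \<in> carrier_vec n"
  shows "act n g l (g *\<^sub>v x) (g *\<^sub>v y) = g *\<^sub>v l x y"
  using assms GL_carrier[OF assms(1)] by (simp add: act_def GL_inv_cancel)

text \<open>Since \<open>g\<close> is onto, all pairs of carrier vectors have the form
  \<open>g *\<^sub>v x\<close>, \<open>g *\<^sub>v y\<close>; off the carrier both sides are
  \<open>undefined\<close> by extensionality.\<close>

lemma act_eqI:
  assumes "g \<in> GL n" "m \<in> algs n"
    and eq: "\<And>x y. x \<in> carrier_vec n \<Longrightarrow> y \<in> carrier_vec n \<Longrightarrow> m (g *\<^sub>v x) (g *\<^sub>v y) = g *\<^sub>v l x y"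
  shows "m = act n g l"
proof (rule ext, rule ext)
  fix x y
  show "m x y = act n g l x y"
  proof (cases "x \<in> carrier_vec n \<and> y \<in> carrier_vec n")
    case True
    then show ?thesis
      using eq[of "GL_inv n g *\<^sub>v x" "GL_inv n g *\<^sub>v y"] GL_carrier[OF assms(1)]
      by (simp add: act_def GL_inv_cancel[OF assms(1)])
  next
    case False
    then show ?thesis
      using assms(2) by (auto simp: act_def algs_def PiE_def extensional_def restrict_def)
  qed
qed

lemma act_mult:
  assumes "g \<in> GL n" "h \<in> GL n" "l \<in> algs n"
  shows "act n g (act n h l) = act n (g * h) l"
proof (rule act_eqI)
  fix x y :: "complex vec" assume xy: "x \<in> carrier_vec n" "y \<in> carrier_vec n"
  note c = GL_carrier(1)[OF assms(1)] GL_carrier(1)[OF assms(2)] algsD(1)[OF assms(3) xy]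
  show "act n g (act n h l) (g * h *\<^sub>v x) (g * h *\<^sub>v y) = g * h *\<^sub>v l x y"
    using c xy by (simp add: act_apply assms)
qed (use assms in \<open>auto intro: GL_mult act_in_algs\<close>)

section \<open>Expansion in structure constants\<close>

lemma algs_expand:
  assumes l: "l \<in> algs n" and x: "x \<in> carrier_vec n" and y: "y \<in> carrier_vec n" and k: "k < n"
  shows "l x y $ k = (\<Sum>i<n. \<Sum>j<n. x $ i * y $ j * l (unit_vec n i) (unit_vec n j) $ k)"
proof -
  \<comment> \<open>\<open>tr v m\<close> keeps the first \<open>m\<close> entries of
    \<open>v\<close>, so that induction on \<open>m\<close> adds one basis vector at a time.\<close>
  define tr where "tr v m = vec n (\<lambda>i. if i < m then v $ i else 0)" for v :: "complex vec" and m :: nat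
  have tr_carrier: "tr v m \<in> carrier_vec n" for v m
    by (simp add: tr_def)
  have tr_Suc: "tr v (Suc m) = tr v m + v $ m \<cdot>\<^sub>v unit_vec n m" for v m
    by (rule eq_vecI) (auto simp: tr_def less_Suc_eq unit_vec_def)
  \<comment> \<open>The form \<open>0 \<cdot>\<^sub>v 0\<^sub>v n\<close> lets homogeneity give the
    base case.\<close>
  have tr_0: "tr v 0 = 0 \<cdot>\<^sub>v 0\<^sub>v n" for v
    by (rule eq_vecI) (auto simp: tr_def)
  have tr_n: "tr v n = v" if "v \<in> carrier_vec n" for v
    using that by (intro eq_vecI) (auto simp: tr_def)
  have expand: "f v $ k = (\<Sum>i<n. v $ i * f (unit_vec n i) $ k)"
    if v: "v \<in> carrier_vec n"
      and f: "\<And>u. u \<in> carrier_vec n \<Longrightarrow> f u \<in> carrier_vec n"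
        "\<And>u w. u \<in> carrier_vec n \<Longrightarrow> w \<in> carrier_vec n \<Longrightarrow> f (u + w) = f u + f w"
        "\<And>u c. u \<in> carrier_vec n \<Longrightarrow> f (c \<cdot>\<^sub>v u) = c \<cdot>\<^sub>v f u"
    for f :: "complex vec \<Rightarrow> complex vec" and v
  proof -
    have "f (tr v m) $ k = (\<Sum>i<m. v $ i * f (unit_vec n i) $ k)" if "m \<le> n" for m
      using that
    proof (induction m)
      case 0
      then show ?case using f(1)[of "0\<^sub>v n"] k by (simp add: tr_0 f(3))
    next
      case (Suc m)
      then show ?case using f(1)[OF tr_carrier[of v m]] f(1)[of "unit_vec n m"] k
        by (simp add: tr_Suc f(2,3) tr_carrier)
    qed
    from this[of n] show ?thesis by (simp add: tr_n v)
  qed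
  have "l x y $ k = (\<Sum>i<n. x $ i * l (unit_vec n i) y $ k)"
    using algsD[OF l] y by (intro expand[of x "\<lambda>u. l u y", OF x]) auto
  also have "\<dots> = (\<Sum>i<n. x $ i * (\<Sum>j<n. y $ j * l (unit_vec n i) (unit_vec n j) $ k))"
    using algsD[OF l]
    by (intro sum.cong refl arg_cong[where f = "(*) _"] expand[of y "l _", OF y]) auto
  finally show ?thesis by (simp add: sum_distrib_left mult.assoc)
qed

lemma algs_zero:
  assumes l: "l \<in> algs n" and v: "v \<in> carrier_vec n"
  shows "l (0\<^sub>v n) v = 0\<^sub>v n" "l v (0\<^sub>v n) = 0\<^sub>v n"
proof -
  have z: "0 \<cdot>\<^sub>v u = 0\<^sub>v n" if "u \<in> carrier_vec n" for u :: "complex vec"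
    using that by (intro eq_vecI) auto
  show "l (0\<^sub>v n) v = 0\<^sub>v n" "l v (0\<^sub>v n) = 0\<^sub>v n"
    using algsD(4)[OF l v v, of 0] algsD(5)[OF l v v, of 0] z[OF v] z[OF algsD(1)[OF l v v]]
    by simp_all
qed

section \<open>Completing independent vectors to a basis\<close>

lemma mat_col_unit:
  fixes A :: "complex mat"
  assumes "A \<in> carrier_mat n n" "j < n"
  shows "A *\<^sub>v unit_vec n j = col A j"
  using assms by (intro eq_vecI) (auto simp: scalar_prod_right_unit)

lemma extend_frame:
  assumes ik: "k \<le> i" "i < n" and v: "v \<in> carrier_vec n" "v $ i \<noteq> 0"
  shows "\<exists>P\<in>GL n. (\<forall>j<k. P *\<^sub>v unit_vec n j = unit_vec n j) \<and> P *\<^sub>v unit_vec n k = v"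
proof -
  \<comment> \<open>The identity matrix with \<open>v\<close> put in column \<open>k\<close>; if
    \<open>i \<noteq> k\<close>, the displaced \<open>e_k\<close> moves to column
    \<open>i\<close>.\<close>
  define P where "P = mat n n (\<lambda>(r, c). if c = k then v $ r else if c = i then (if r = k then 1 else 0)
    else if r = c then 1 else 0)"
  have P: "P \<in> carrier_mat n n" by (simp add: P_def)
  have entry: "(P *\<^sub>v w) $ r = w $ k * v $ r + (if r = k then if i = k then 0 else w $ i
      else if r = i then 0 else w $ r)"
    if w: "w \<in> carrier_vec n" and r: "r < n" for w r
  proof -
    have "(P *\<^sub>v w) $ r = (\<Sum>c<n. P $$ (r, c) * w $ c)"
      using P w r by (simp add: scalar_prod_def atLeast0LessThan)
    also have "\<dots> = (\<Sum>c<n. (if c = k then w $ k * v $ r else 0)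
        + (if c = (if r = k then i else r) then (if r = k then if i = k then 0 else w $ i
           else if r = i then 0 else w $ r) else 0))"
      using r by (intro sum.cong refl) (auto simp: P_def)
    also have "\<dots> = w $ k * v $ r + (if r = k then if i = k then 0 else w $ i
      else if r = i then 0 else w $ r)"
      using r ik unfolding sum.distrib by (simp add: sum.delta)
    finally show ?thesis .
  qed
  have "P \<in> GL n"
  proof (rule GL_I[OF P])
    fix w assume w: "w \<in> carrier_vec n" and 0: "P *\<^sub>v w = 0\<^sub>v n"
    have z: "w $ k * v $ r + (if r = k then if i = k then 0 else w $ i
      else if r = i then 0 else w $ r) = 0" if "r < n" for r
      using entry[OF w that] 0 that by simp
    \<comment> \<open>Row \<open>i\<close> of \<open>P *\<^sub>v w = 0\<close> reads
      \<open>w $ k * v $ i = 0\<close>.\<close>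
    have wk: "w $ k = 0" using z[of i] ik v by (cases "i = k") simp_all
    have "w $ r = 0" if r: "r < n" for r
    proof (cases "r = k \<or> r = i")
      case True
      have "k < n" using ik by simp
      from z[OF this] True wk show ?thesis by (cases "i = k") auto
    next
      case False
      then show ?thesis using z[OF r] wk by simp
    qed
    then show "w = 0\<^sub>v n" using w by (intro eq_vecI) auto
  qed
  moreover have "P *\<^sub>v unit_vec n j = unit_vec n j" if j: "j < k" for j
  proof -
    have "j < n" using j ik by simp
    then show ?thesis using j ik
      unfolding mat_col_unit[OF P \<open>j < n\<close>] by (intro eq_vecI) (simp_all add: P_def)
  qed
  moreover have "P *\<^sub>v unit_vec n k = v"
  proof -
    have "k < n" using ik by simp
    then show ?thesis using v(1)
      unfolding mat_col_unit[OF P \<open>k < n\<close>] by (intro eq_vecI) (simp_all add: P_def)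
  qed
  ultimately show ?thesis by (intro bexI[of _ P] conjI allI impI)
qed

text \<open>Pulled back by the matrix \<open>P\<close> built so far, the next vector has a nonzero
  entry at some index \<open>\<ge> k\<close>, as otherwise it would be a combination of its
  predecessors. \<open>extend_frame\<close> then supplies a right factor that leaves the first
  \<open>k\<close> columns alone.\<close>

lemma obtain_frame:
  assumes "k \<le> n" "\<And>j. j < k \<Longrightarrow> vs j \<in> carrier_vec n"
    and "\<And>j c. j < k \<Longrightarrow> vs j \<noteq> vec n (\<lambda>r. \<Sum>i<j. c i * vs i $ r)"
  shows "\<exists>P\<in>GL n. \<forall>j<k. P *\<^sub>v unit_vec n j = vs j"
  using assms
proof (induction k)
  case 0
  have "1\<^sub>m n \<in> GL n" by (rule GL_I) auto
  then show ?case by auto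
next
  case (Suc k)
  have "\<exists>P\<in>GL n. \<forall>j<k. P *\<^sub>v unit_vec n j = vs j"
    using Suc.prems(1) by (intro Suc.IH Suc.prems(2,3)) auto
  then obtain P where P: "P \<in> GL n" and Pj: "\<And>j. j < k \<Longrightarrow> P *\<^sub>v unit_vec n j = vs j"
    by blast
  note Pc = GL_carrier[OF P]
  define v where "v = GL_inv n P *\<^sub>v vs k"
  have v: "v \<in> carrier_vec n" and Pv: "P *\<^sub>v v = vs k"
    using Suc.prems(2)[of k] Pc by (auto simp: v_def GL_inv_cancel(2)[OF P])
  have "\<exists>i\<ge>k. i < n \<and> v $ i \<noteq> 0"
  proof (rule ccontr)
    assume "\<not> ?thesis"
    then have z: "v $ i = 0" if "k \<le> i" "i < n" for i using that by auto
    have "vs k $ r = (\<Sum>i<k. v $ i * vs i $ r)" if r: "r < n" for r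
    proof -
      have "vs k $ r = (\<Sum>i<n. P $$ (r, i) * v $ i)"
        using Pc v r unfolding Pv[symmetric] by (simp add: scalar_prod_def atLeast0LessThan)
      also have "\<dots> = (\<Sum>i<k. P $$ (r, i) * v $ i)"
        using z Suc.prems(1) by (intro sum.mono_neutral_right) auto
      also have "\<dots> = (\<Sum>i<k. v $ i * vs i $ r)"
        using Pc r Suc.prems(1)
        by (intro sum.cong refl) (auto simp: Pj[symmetric] mat_col_unit[OF Pc(1)])
      finally show ?thesis .
    qed
    then have "vs k = vec n (\<lambda>r. \<Sum>i<k. v $ i * vs i $ r)"
      using Suc.prems(2)[of k] by (intro eq_vecI) auto
    then show False using Suc.prems(3)[of k] by blast
  qed
  then obtain i where "k \<le> i" "i < n" "v $ i \<noteq> 0" by blast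
  from extend_frame[OF this(1,2) v this(3)] obtain Q where Q: "Q \<in> GL n"
    and Qj: "\<And>j. j < k \<Longrightarrow> Q *\<^sub>v unit_vec n j = unit_vec n j" and Qk: "Q *\<^sub>v unit_vec n k = v"
    by blast
  have "(P * Q) *\<^sub>v unit_vec n j = vs j" if "j < Suc k" for j
    using that Pc(1) GL_carrier(1)[OF Q] Pj Qj Qk Pv by (cases "j = k") auto
  then show ?case using GL_mult[OF P Q] by blast
qed

section \<open>Degenerations as limits\<close>

lemma poly_funs_tendsto:
  assumes "p \<in> poly_funs n"
    and "\<And>i j k. \<lbrakk>i < n; j < n; k < n\<rbrakk> \<Longrightarrow>
      ((\<lambda>t. L t (unit_vec n i) (unit_vec n j) $ k) \<longlongrightarrow> m (unit_vec n i) (unit_vec n j) $ k) F"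
  shows "((\<lambda>t. p (L t)) \<longlongrightarrow> p m) F"
  using assms(1) by induction (auto intro: tendsto_intros assms(2))

text \<open>For fixed \<open>h\<close> the new structure constants are linear forms in the old ones,
  so coordinatewise limits pass through \<open>act n h\<close>.\<close>

lemma act_coord:
  assumes h: "h \<in> GL n" and l: "l \<in> algs n" and x: "x \<in> carrier_vec n" and y: "y \<in> carrier_vec n"
    and k: "k < n"
  shows "act n h l x y $ k = (\<Sum>r<n. h $$ (k, r) * (\<Sum>p<n. \<Sum>q<n.
    (GL_inv n h *\<^sub>v x) $ p * (GL_inv n h *\<^sub>v y) $ q * l (unit_vec n p) (unit_vec n q) $ r))"
proof -
  note c = GL_carrier[OF h]
  have uw: "GL_inv n h *\<^sub>v x \<in> carrier_vec n" "GL_inv n h *\<^sub>v y \<in> carrier_vec n"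
    using c x y by auto
  have "act n h l x y $ k = (h *\<^sub>v l (GL_inv n h *\<^sub>v x) (GL_inv n h *\<^sub>v y)) $ k"
    using x y by (simp add: act_def)
  also have "\<dots> = (\<Sum>r<n. h $$ (k, r) * l (GL_inv n h *\<^sub>v x) (GL_inv n h *\<^sub>v y) $ r)"
    using c(1) k algsD(1)[OF l uw] by (simp add: scalar_prod_def atLeast0LessThan)
  also have "\<dots> = (\<Sum>r<n. h $$ (k, r) * (\<Sum>p<n. \<Sum>q<n.
    (GL_inv n h *\<^sub>v x) $ p * (GL_inv n h *\<^sub>v y) $ q * l (unit_vec n p) (unit_vec n q) $ r))"
    by (intro sum.cong refl arg_cong[where f = "(*) _"] algs_expand[OF l uw]) simp
  finally show ?thesis .
qed

text \<open>Polynomial functions are continuous, so no algebraic geometry is needed to see that a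
  Euclidean limit of points of an orbit lies in the Zariski closure of the orbit.\<close>

lemma degenerates_limit:
  fixes g :: "complex \<Rightarrow> complex mat"
  assumes l: "l \<in> algs n" and m: "m \<in> algs n" and g: "\<And>t. t \<noteq> 0 \<Longrightarrow> g t \<in> GL n"
    and lim: "\<And>i j k. \<lbrakk>i < n; j < n; k < n\<rbrakk> \<Longrightarrow>
      ((\<lambda>t. act n (g t) l (unit_vec n i) (unit_vec n j) $ k)
        \<longlongrightarrow> m (unit_vec n i) (unit_vec n j) $ k) (at 0)"
  shows "degenerates n l m"
  unfolding degenerates_def
proof
  fix m' assume "m' \<in> Orb n m"
  then obtain h where h: "h \<in> GL n" and m': "m' = act n h m" by (auto simp: Orb_def)
  \<comment> \<open>The closure must contain the whole orbit of \<open>m\<close>, so the limit is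
    carried over to \<open>m' = act n h m\<close>.\<close>
  have lim': "((\<lambda>t. act n h (act n (g t) l) (unit_vec n i) (unit_vec n j) $ k)
      \<longlongrightarrow> m' (unit_vec n i) (unit_vec n j) $ k) (at 0)" if "i < n" "j < n" "k < n" for i j k
  proof (rule Lim_transform_eventually)
    let ?u = "\<lambda>i. GL_inv n h *\<^sub>v unit_vec n i"
    show "((\<lambda>t. \<Sum>r<n. h $$ (k, r) * (\<Sum>p<n. \<Sum>q<n. ?u i $ p * ?u j $ q *
        act n (g t) l (unit_vec n p) (unit_vec n q) $ r)) \<longlongrightarrow> m' (unit_vec n i) (unit_vec n j) $ k) (at 0)"
      unfolding m' act_coord[OF h m unit_vec_carrier unit_vec_carrier that(3)]
      by (intro tendsto_intros lim) auto
    show "\<forall>\<^sub>F t in at 0. (\<Sum>r<n. h $$ (k, r) * (\<Sum>p<n. \<Sum>q<n. ?u i $ p * ?u j $ q *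
        act n (g t) l (unit_vec n p) (unit_vec n q) $ r))
        = act n h (act n (g t) l) (unit_vec n i) (unit_vec n j) $ k"
      unfolding eventually_at_filter
      by (intro always_eventually allI impI
          act_coord[OF h act_in_algs[OF l g] unit_vec_carrier unit_vec_carrier that(3), symmetric])
  qed
  have "m' \<in> Z" if Z: "zariski_closed n Z" and sub: "Orb n l \<subseteq> Z" for Z
  proof -
    obtain P where P: "P \<subseteq> poly_funs n" and Z: "Z = {l \<in> algs n. \<forall>p\<in>P. p l = 0}"
      using Z by (auto simp: zariski_closed_def)
    \<comment> \<open>The curve stays in the orbit of \<open>l\<close>, where \<open>p\<close>
      vanishes; uniqueness of limits gives the same at \<open>m'\<close>.\<close>
    have "p m' = 0" if p: "p \<in> P" for p
    proof (rule tendsto_unique)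
      show "((\<lambda>t. p (act n h (act n (g t) l))) \<longlongrightarrow> p m') (at 0)"
        using p P by (intro poly_funs_tendsto[of p n] lim') auto
      have "p (act n h (act n (g t) l)) = 0" if "t \<noteq> 0" for t
      proof -
        have "act n h (act n (g t) l) \<in> Orb n l"
          using act_mult[OF h g[OF that] l] GL_mult[OF h g[OF that]] by (auto simp: Orb_def)
        then show ?thesis using sub p by (auto simp: Z)
      qed
      then show "((\<lambda>t. p (act n h (act n (g t) l))) \<longlongrightarrow> 0) (at 0)"
        by (intro tendsto_eventually) (simp add: eventually_at_filter)
    qed simp
    then show ?thesis using act_in_algs[OF m h] by (simp add: Z m')
  qed
  then show "m' \<in> zariski_closure n (Orb n l)"
    by (auto simp: zariski_closure_def hull_def)
qed

text \<open>The orbit of \<open>act n g l\<close> lies in that of \<open>l\<close>, and hulls are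
  monotone.\<close>

lemma degenerates_act:
  assumes "g \<in> GL n" "l \<in> algs n" "degenerates n (act n g l) m"
  shows "degenerates n l m"
proof -
  have "Orb n (act n g l) \<subseteq> Orb n l"
    using act_mult[OF _ assms(1,2)] GL_mult[OF _ assms(1)] by (auto simp: Orb_def)
  then show ?thesis
    using assms(3) hull_mono unfolding degenerates_def zariski_closure_def by fast
qed

text \<open>A one-parameter diagonal group \<open>E\<^sub>i = t\<^bsup>a i\<^esup> e\<^sub>i\<close> multiplies the structure
  constant with indices \<open>i, j, k\<close> by \<open>t\<^bsup>a i + a j - a k\<^esup>\<close>.\<close>

lemma degenerates_weights:
  fixes a :: "nat \<Rightarrow> nat"
  assumes l: "l \<in> algs n" and m: "m \<in> algs n"
    and W: "\<And>i j k. \<lbrakk>i < n; j < n; k < n\<rbrakk> \<Longrightarrow>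
      a i + a j = a k \<and> m (unit_vec n i) (unit_vec n j) $ k = l (unit_vec n i) (unit_vec n j) $ k \<or>
      a i + a j > a k \<and> m (unit_vec n i) (unit_vec n j) $ k = 0 \<or>
      l (unit_vec n i) (unit_vec n j) $ k = 0 \<and> m (unit_vec n i) (unit_vec n j) $ k = 0"
  shows "degenerates n l m"
proof (rule degenerates_limit[OF l m])
  \<comment> \<open>The powers are inverse because \<open>act\<close> evaluates \<open>l\<close> at
    preimages: \<open>D t\<close> sends \<open>t ^ a i \<cdot>\<^sub>v e_i\<close> to
    \<open>e_i\<close>.\<close>
  define D where "D t = mat n n (\<lambda>(r, c). if r = c then inverse t ^ a r else 0)" for t :: complex
  have Dc: "D t \<in> carrier_mat n n" for t by (simp add: D_def)
  have D_entry: "(D t *\<^sub>v w) $ r = inverse t ^ a r * w $ r" if "w \<in> carrier_vec n" "r < n" for t w r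
  proof -
    have "(D t *\<^sub>v w) $ r = (\<Sum>c<n. (if r = c then inverse t ^ a r else 0) * w $ c)"
      using that by (simp add: D_def scalar_prod_def atLeast0LessThan)
    also have "\<dots> = (\<Sum>c<n. if c = r then inverse t ^ a r * w $ r else 0)"
      by (intro sum.cong refl) auto
    finally show ?thesis using that by simp
  qed
  show D: "D t \<in> GL n" if "t \<noteq> 0" for t
  proof (rule GL_I[OF Dc])
    fix w :: "complex vec" assume w: "w \<in> carrier_vec n" "D t *\<^sub>v w = 0\<^sub>v n"
    have "w $ r = 0" if "r < n" for r
      using D_entry[OF w(1) that, of t] w(2) \<open>t \<noteq> 0\<close> that by simp
    then show "w = 0\<^sub>v n" using w(1) by (intro eq_vecI) auto
  qed
  fix i j k assume ijk: "i < n" "j < n" "k < n"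
  let ?c = "l (unit_vec n i) (unit_vec n j) $ k"
  have unit: "D t *\<^sub>v (t ^ a r \<cdot>\<^sub>v unit_vec n r) = unit_vec n r" if "t \<noteq> 0" "r < n" for t r
  proof (rule eq_vecI)
    fix s assume "s < dim_vec (unit_vec n r :: complex vec)"
    then show "(D t *\<^sub>v (t ^ a r \<cdot>\<^sub>v unit_vec n r)) $ s = unit_vec n r $ s"
      using that by (subst D_entry) (auto simp: power_inverse)
  qed (simp add: D_def)
  have coord: "act n (D t) l (unit_vec n i) (unit_vec n j) $ k = t ^ (a i + a j) / t ^ a k * ?c"
    if t: "t \<noteq> 0" for t
  proof -
    have "act n (D t) l (unit_vec n i) (unit_vec n j)
        = D t *\<^sub>v l (t ^ a i \<cdot>\<^sub>v unit_vec n i) (t ^ a j \<cdot>\<^sub>v unit_vec n j)"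
      using act_apply[OF D[OF t], of "t ^ a i \<cdot>\<^sub>v unit_vec n i" "t ^ a j \<cdot>\<^sub>v unit_vec n j" l]
      by (simp add: unit[OF t] ijk)
    also have "\<dots> = D t *\<^sub>v (t ^ (a i + a j) \<cdot>\<^sub>v l (unit_vec n i) (unit_vec n j))"
      by (simp add: algsD[OF l] smult_smult_assoc power_add mult.commute)
    finally show ?thesis using ijk algsD(1)[OF l, of "unit_vec n i" "unit_vec n j"]
      by (simp add: D_entry divide_inverse power_inverse mult.commute)
  qed
  \<comment> \<open>Weight 0 keeps the constant and positive weight sends it to 0. Negative weight,
    where the power of \<open>t\<close> blows up, is allowed by \<open>W\<close> only if the
    constant vanishes.\<close>
  have lim: "((\<lambda>t. t ^ (a i + a j) / t ^ a k * ?c) \<longlongrightarrow> m (unit_vec n i) (unit_vec n j) $ k) (at 0)"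
    using W[OF ijk]
  proof (elim disjE conjE)
    assume *: "a i + a j = a k" "m (unit_vec n i) (unit_vec n j) $ k = ?c"
    show ?thesis
      by (rule tendsto_eventually) (simp add: * eventually_at_filter)
  next
    assume *: "a k < a i + a j" "m (unit_vec n i) (unit_vec n j) $ k = 0"
    have "((\<lambda>t. t ^ (a i + a j - a k) * ?c) \<longlongrightarrow> 0 ^ (a i + a j - a k) * ?c) (at 0)"
      by (intro tendsto_intros)
    moreover have "\<forall>\<^sub>F t in at (0 :: complex). t ^ (a i + a j - a k) * ?c = t ^ (a i + a j) / t ^ a k * ?c"
      using *(1) by (simp add: eventually_at_filter power_diff)
    ultimately show ?thesis
      using * by (auto dest: Lim_transform_eventually simp: power_0_left)
  qed simp
  show "((\<lambda>t. act n (D t) l (unit_vec n i) (unit_vec n j) $ k)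
      \<longlongrightarrow> m (unit_vec n i) (unit_vec n j) $ k) (at 0)"
    by (rule Lim_transform_eventually[OF lim]) (simp add: eventually_at_filter coord)
qed

section \<open>Passing to an adapted basis\<close>

text \<open>\<open>l'\<close> is \<open>act n (GL_inv n P) l\<close>, that is, \<open>l\<close>
  written in the basis of columns of \<open>P\<close>; \<open>degenerates_act\<close> transfers its
  degenerations to \<open>l\<close>.\<close>

lemma change_of_frame:
  assumes l: "l \<in> algs n" and "k \<le> n" "\<forall>j<k. vs j \<in> carrier_vec n"
    and "\<forall>j<k. \<forall>c. vs j \<noteq> vec n (\<lambda>r. \<Sum>i<j. c i * vs i $ r)"
  shows "\<exists>P\<in>GL n. \<exists>l'\<in>algs n. (\<forall>j<k. P *\<^sub>v unit_vec n j = vs j) \<and>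
    (\<forall>x\<in>carrier_vec n. \<forall>y\<in>carrier_vec n. l' x y = GL_inv n P *\<^sub>v l (P *\<^sub>v x) (P *\<^sub>v y)) \<and>
    (\<forall>m. degenerates n l' m \<longrightarrow> degenerates n l m)"
proof -
  obtain P where P: "P \<in> GL n" "\<And>j. j < k \<Longrightarrow> P *\<^sub>v unit_vec n j = vs j"
    using obtain_frame[of k n vs] assms(2-4) by blast
  note c = GL_carrier[OF P(1)]
  have "act n (GL_inv n P) l x y = GL_inv n P *\<^sub>v l (P *\<^sub>v x) (P *\<^sub>v y)"
    if "x \<in> carrier_vec n" "y \<in> carrier_vec n" for x y
    using that act_apply[OF c(3), of "P *\<^sub>v x" "P *\<^sub>v y" l] c(1)
    by (simp add: GL_inv_cancel[OF P(1)])
  then show ?thesis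
    using P degenerates_act[OF c(3) l]
    by (intro bexI[OF _ P(1)] bexI[OF _ act_in_algs[OF l c(3)]]) auto
qed

section \<open>Structure constants of the target algebras, with indices starting at 0\<close>

lemma lambda2_sum_coord:
  assumes "2 \<le> n" "i < n" "j < n" "k < n"
  shows "alg_sum 2 (n - 2) lambda2 (zero_alg (n - 2)) (unit_vec n i) (unit_vec n j) $ k
    = (if i = 0 \<and> j = 0 \<and> k = 1 then 1 else 0)"
proof -
  have s: "{Suc 0..2} = {1, 2::nat}" by auto
  have l2: "lambda2 x y $ r = (if r = 1 then x $ 0 * y $ 0 else 0)"
    if "x \<in> carrier_vec 2" "y \<in> carrier_vec 2" "r < 2" for x y r
    using that by (auto simp: lambda2_def table_alg_def bvec_def s)
  have l2_dim: "dim_vec (lambda2 x y) = 2" if "x \<in> carrier_vec 2" "y \<in> carrier_vec 2" for x y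
    using that by (auto simp: lambda2_def table_alg_def)
  have "Suc (Suc (n - 2)) = n" using assms(1) by simp
  then show ?thesis
    using assms by (auto simp: alg_sum_def l2 l2_dim zero_alg_def vec_first_def vec_last_def)
qed

lemma n3_minus_sum_coord:
  assumes "3 \<le> n" "i < n" "j < n" "k < n"
  shows "alg_sum 3 (n - 3) n3_minus (zero_alg (n - 3)) (unit_vec n i) (unit_vec n j) $ k
    = (if i = 0 \<and> j = 1 \<and> k = 2 then 1 else if i = 1 \<and> j = 0 \<and> k = 2 then - 1 else 0)"
proof -
  have s: "{Suc 0..3} = {1, 2, 3::nat}" by auto
  have n3: "n3_minus x y $ r = (if r = 2 then x $ 0 * y $ 1 - x $ 1 * y $ 0 else 0)"
    if "x \<in> carrier_vec 3" "y \<in> carrier_vec 3" "r < 3" for x y r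
    using that by (auto simp: n3_minus_def table_alg_def bvec_def s numeral_2_eq_2)
  have n3_dim: "dim_vec (n3_minus x y) = 3" if "x \<in> carrier_vec 3" "y \<in> carrier_vec 3" for x y
    using that by (auto simp: n3_minus_def table_alg_def)
  show ?thesis
    using assms by (auto simp: alg_sum_def n3 n3_dim zero_alg_def vec_first_def vec_last_def)
qed

lemma nu_coord:
  assumes "i < n" "j < n" "k < n"
  shows "nu n \<alpha> (unit_vec n i) (unit_vec n j) $ k =
    (if i = 0 then if j = k then if j = 0 then 1 else \<alpha> else 0
     else if j = 0 \<and> i = k then 1 - \<alpha> else 0)"
  using table_alg_basis[of "Suc i" n "Suc j"] assms by (auto simp: nu_def bvec_def)

lemma p_minus_coord:
  assumes "i < n" "j < n" "k < n"
  shows "p_minus n (unit_vec n i) (unit_vec n j) $ k =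
    (if i = 0 then if j = k \<and> j \<noteq> 0 then 1 else 0
     else if j = 0 \<and> i = k then - 1 else 0)"
  using table_alg_basis[of "Suc i" n "Suc j"] assms by (auto simp: p_minus_def bvec_def)

lemma target_in_algs:
  "p_minus n \<in> algs n" "nu n \<alpha> \<in> algs n"
  "2 \<le> n \<Longrightarrow> alg_sum 2 (n - 2) lambda2 (zero_alg (n - 2)) \<in> algs n"
  "3 \<le> n \<Longrightarrow> alg_sum 3 (n - 3) n3_minus (zero_alg (n - 3)) \<in> algs n"
  using alg_sum_in_algs[OF _ zero_alg_in_algs, of lambda2 2 "n - 2"]
    alg_sum_in_algs[OF _ zero_alg_in_algs, of n3_minus 3 "n - 3"]
  unfolding p_minus_def nu_def lambda2_def n3_minus_def
  by (simp_all only: table_alg_in_algs le_add_diff_inverse)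

section \<open>Independent pairs and triples as frames\<close>

lemma pair_frame:
  fixes x y :: "complex vec"
  assumes "x \<in> carrier_vec n" "x \<noteq> 0\<^sub>v n" "\<And>c. y \<noteq> c \<cdot>\<^sub>v x"
  shows "\<forall>j<2. \<forall>c. [x, y] ! j \<noteq> vec n (\<lambda>r. \<Sum>i<j. c i * [x, y] ! i $ r)"
proof (intro allI impI)
  fix j :: nat and c :: "nat \<Rightarrow> complex" assume "j < 2"
  \<comment> \<open>For \<open>j = 0\<close> the sum is empty and the claim is
    \<open>x \<noteq> 0\<close>; for \<open>j = 1\<close> it says that \<open>y\<close> is no
    multiple of \<open>x\<close>.\<close>
  have "vec n (\<lambda>r. c 0 * x $ r) = c 0 \<cdot>\<^sub>v x" using assms(1) by (intro eq_vecI) auto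
  then show "[x, y] ! j \<noteq> vec n (\<lambda>r. \<Sum>i<j. c i * [x, y] ! i $ r)"
    using \<open>j < 2\<close> assms(2) assms(3)[of "c 0"] by (auto simp: less_2_cases_iff zero_vec_def)
qed

lemma triple_frame:
  fixes x y z :: "complex vec"
  assumes "x \<in> carrier_vec n" "y \<in> carrier_vec n" "x \<noteq> 0\<^sub>v n" "\<And>c. y \<noteq> c \<cdot>\<^sub>v x"
    "\<And>a b. z \<noteq> a \<cdot>\<^sub>v x + b \<cdot>\<^sub>v y"
  shows "\<forall>j<3. \<forall>c. [x, y, z] ! j \<noteq> vec n (\<lambda>r. \<Sum>i<j. c i * [x, y, z] ! i $ r)"
proof (intro allI impI)
  fix j :: nat and c :: "nat \<Rightarrow> complex" assume j: "j < 3"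
  show "[x, y, z] ! j \<noteq> vec n (\<lambda>r. \<Sum>i<j. c i * [x, y, z] ! i $ r)"
  proof (cases "j = 2")
    case True
    have "vec n (\<lambda>r. c 0 * x $ r + c 1 * y $ r) = c 0 \<cdot>\<^sub>v x + c 1 \<cdot>\<^sub>v y"
      using assms(1,2) by (intro eq_vecI) auto
    then show ?thesis using True assms(5)[of "c 0" "c 1"] by (simp add: numeral_2_eq_2)
  next
    case False
    then have "j = 0 \<or> j = 1" using j by auto
    then show ?thesis using pair_frame[OF assms(1,3,4), rule_format, of j c] by auto
  qed
qed

section \<open>Some square leaves the line of its base\<close>

lemma degenerates_lambda2:
  assumes n: "2 \<le> n" and l: "l \<in> algs n" and x: "x \<in> carrier_vec n"
    and indep: "\<And>c. l x x \<noteq> c \<cdot>\<^sub>v x"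
  shows "degenerates n l (alg_sum 2 (n - 2) lambda2 (zero_alg (n - 2)))"
proof -
  have x0: "x \<noteq> 0\<^sub>v n"
  proof
    assume "x = 0\<^sub>v n"
    then have "l x x = 0 \<cdot>\<^sub>v x" using algs_zero(1)[OF l x] by (intro eq_vecI) auto
    then show False using indep by blast
  qed
  have carrier: "\<forall>j<2. [x, l x x] ! j \<in> carrier_vec n"
    using x algsD(1)[OF l x x] by (auto simp: less_2_cases_iff)
  obtain P l' where P: "P \<in> GL n" and l': "l' \<in> algs n"
    and frame: "\<forall>j<2. P *\<^sub>v unit_vec n j = [x, l x x] ! j"
      "\<forall>x\<in>carrier_vec n. \<forall>y\<in>carrier_vec n. l' x y = GL_inv n P *\<^sub>v l (P *\<^sub>v x) (P *\<^sub>v y)"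
      "\<forall>m. degenerates n l' m \<longrightarrow> degenerates n l m"
    using change_of_frame[OF l n carrier pair_frame[OF x x0 indep]]
    by (elim bexE conjE) (rule that)
  note Pj = frame(1)[rule_format] and l'_eq = frame(2)[rule_format] and deg = frame(3)[rule_format]
  have sq: "l' (unit_vec n 0) (unit_vec n 0) = unit_vec n 1"
    using Pj[of 0] Pj[of 1] GL_inv_cancel(1)[OF P, of "unit_vec n 1"] by (simp add: l'_eq)
  \<comment> \<open>The weight fails to be positive only for \<open>i = j = 0\<close>,
    \<open>k > 0\<close>. There it is 0, and \<open>sq\<close> identifies the constants.\<close>
  show ?thesis
  proof (rule deg, rule degenerates_weights[OF l' target_in_algs(3)[OF n], where a = "\<lambda>i. if i = 0 then 1 else 2"])
    fix i j k assume ijk: "i < n" "j < n" "k < n"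
    show "(if i = 0 then 1 else 2) + (if j = 0 then 1 else 2) = (if k = 0 then 1 else (2::nat)) \<and>
        alg_sum 2 (n - 2) lambda2 (zero_alg (n - 2)) (unit_vec n i) (unit_vec n j) $ k
          = l' (unit_vec n i) (unit_vec n j) $ k \<or>
      (if k = 0 then 1 else 2) < (if i = 0 then 1 else 2) + (if j = 0 then 1 else (2::nat)) \<and>
        alg_sum 2 (n - 2) lambda2 (zero_alg (n - 2)) (unit_vec n i) (unit_vec n j) $ k = 0 \<or>
      l' (unit_vec n i) (unit_vec n j) $ k = 0 \<and>
        alg_sum 2 (n - 2) lambda2 (zero_alg (n - 2)) (unit_vec n i) (unit_vec n j) $ k = 0"
      unfolding lambda2_sum_coord[OF n ijk] using ijk
      by (cases "i = 0"; cases "j = 0"; cases "k = 0") (simp_all add: sq)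
  qed
qed

section \<open>Some product leaves the span of its factors\<close>

lemma degenerates_n3_minus:
  assumes n: "3 \<le> n" and l: "l \<in> algs n" and x: "x \<in> carrier_vec n" and y: "y \<in> carrier_vec n"
    and sq: "\<And>u. u \<in> carrier_vec n \<Longrightarrow> \<exists>c. l u u = c \<cdot>\<^sub>v u"
    and indep: "\<And>a b. l x y \<noteq> a \<cdot>\<^sub>v x + b \<cdot>\<^sub>v y"
  shows "degenerates n l (alg_sum 3 (n - 3) n3_minus (zero_alg (n - 3)))"
proof -
  have x0: "x \<noteq> 0\<^sub>v n"
  proof
    assume "x = 0\<^sub>v n"
    then have "l x y = 0 \<cdot>\<^sub>v x + 0 \<cdot>\<^sub>v y" 
      using algs_zero(1)[OF l y] y by (intro eq_vecI) auto
    then show False using indep by blast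
  qed
  have xy: "y \<noteq> c \<cdot>\<^sub>v x" for c
  proof
    assume c: "y = c \<cdot>\<^sub>v x"
    \<comment> \<open>For \<open>y = c x\<close> the product is \<open>c\<close> times a square,
      hence a multiple of \<open>x\<close>.\<close>
    obtain d where "l x x = d \<cdot>\<^sub>v x" using sq[OF x] by blast
    then have "l x y = (c * d) \<cdot>\<^sub>v x + 0 \<cdot>\<^sub>v y"
      using x by (intro eq_vecI) (auto simp: c algsD(5)[OF l x x])
    then show False using indep by blast
  qed
  have carrier: "\<forall>j<3. [x, y, l x y] ! j \<in> carrier_vec n"
    using x y algsD(1)[OF l x y] by (auto simp: less_Suc_eq numeral_3_eq_3)
  obtain P l' where P: "P \<in> GL n" and l': "l' \<in> algs n"
    and frame: "\<forall>j<3. P *\<^sub>v unit_vec n j = [x, y, l x y] ! j"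
      "\<forall>x\<in>carrier_vec n. \<forall>y\<in>carrier_vec n. l' x y = GL_inv n P *\<^sub>v l (P *\<^sub>v x) (P *\<^sub>v y)"
      "\<forall>m. degenerates n l' m \<longrightarrow> degenerates n l m"
    using change_of_frame[OF l n carrier triple_frame[OF x y x0 xy indep]]
    by (elim bexE conjE) (rule that)
  note Pj = frame(1)[rule_format] and l'_eq = frame(2)[rule_format] and deg = frame(3)[rule_format]
  note Pc = GL_carrier[OF P]
  let ?e = "unit_vec n :: nat \<Rightarrow> complex vec"
  have sq': "\<exists>c. l' u u = c \<cdot>\<^sub>v u" if u: "u \<in> carrier_vec n" for u
  proof -
    obtain c where "l (P *\<^sub>v u) (P *\<^sub>v u) = c \<cdot>\<^sub>v (P *\<^sub>v u)" using sq[of "P *\<^sub>v u"] Pc u by auto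
    then show ?thesis
      using Pc u by (auto simp: l'_eq mult_mat_vec[OF Pc(2)] GL_inv_cancel(1)[OF P])
  qed
  have e01: "l' (?e 0) (?e 1) = ?e 2"
    using Pj[of 0] Pj[of 1] Pj[of 2] GL_inv_cancel(1)[OF P, of "?e 2"] by (simp add: l'_eq)
  have diag: "l' (?e i) (?e i) $ k = 0" if "k \<noteq> i" "k < n" "i < n" for i k
    using sq'[of "?e i"] that by auto
  \<comment> \<open>The squares of \<open>e_0\<close>, \<open>e_1\<close> and
    \<open>e_0 + e_1\<close> have no entries at indices \<open>\<ge> 2\<close>, so there
    \<open>e_1 e_0\<close> is the negative of \<open>e_0 e_1\<close>.\<close>
  have e10: "l' (?e 1) (?e 0) $ k = (if k = 2 then - 1 else 0)" if k: "2 \<le> k" "k < n" for k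
  proof -
    obtain c where c: "l' (?e 0 + ?e 1) (?e 0 + ?e 1) = c \<cdot>\<^sub>v (?e 0 + ?e 1)"
      using sq'[of "?e 0 + ?e 1"] by auto
    have carr: "l' (?e i) (?e j) \<in> carrier_vec n" for i j by (simp add: algsD(1)[OF l'])
    have "l' (?e 0 + ?e 1) (?e 0 + ?e 1) $ k
        = (l' (?e 0) (?e 0) + l' (?e 1) (?e 0) + (l' (?e 0) (?e 1) + l' (?e 1) (?e 1))) $ k"
      by (simp add: algsD(2,3)[OF l'])
    also have "\<dots> = l' (?e 1) (?e 0) $ k + ?e 2 $ k"
      using carr[of 0 0] carr[of 1 0] carr[of 1 1] k diag[of k 0] diag[of k 1]
      by (simp add: e01[unfolded One_nat_def])
    finally show ?thesis using c k by (simp add: eq_neg_iff_add_eq_0 split: if_splits)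
  qed
  \<comment> \<open>The weight is 0 for \<open>i, j < 2 \<le> k\<close> and positive otherwise,
    which removes the unknown entries of \<open>e_1 e_0\<close> along \<open>e_0\<close> and
    \<open>e_1\<close>.\<close>
  show ?thesis
  proof (rule deg, rule degenerates_weights[OF l' target_in_algs(4)[OF n], where a = "\<lambda>i. if i < 2 then 1 else 2"])
    fix i j k assume ijk: "i < n" "j < n" "k < n"
    consider "i < 2" "j < 2" "k \<ge> 2" | "i \<ge> 2 \<or> j \<ge> 2 \<or> k < 2" by linarith
    then show "(if i < 2 then 1 else 2) + (if j < 2 then 1 else 2) = (if k < 2 then 1 else (2::nat)) \<and>
        alg_sum 3 (n - 3) n3_minus (zero_alg (n - 3)) (?e i) (?e j) $ k = l' (?e i) (?e j) $ k \<or>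
      (if k < 2 then 1 else 2) < (if i < 2 then 1 else 2) + (if j < 2 then 1 else (2::nat)) \<and>
        alg_sum 3 (n - 3) n3_minus (zero_alg (n - 3)) (?e i) (?e j) $ k = 0 \<or>
      l' (?e i) (?e j) $ k = 0 \<and>
        alg_sum 3 (n - 3) n3_minus (zero_alg (n - 3)) (?e i) (?e j) $ k = 0"
    proof cases
      case 1
      have "(if i = 0 \<and> j = 1 \<and> k = 2 then 1 else if i = 1 \<and> j = 0 \<and> k = 2 then - 1 else 0)
        = l' (?e i) (?e j) $ k"
      proof (cases "i = j")
        case True
        then show ?thesis using 1 ijk diag[of k i] by simp
      next
        case False
        then consider "i = 0" "j = 1" | "i = 1" "j = 0" using 1 by linarith
        then show ?thesis using 1 ijk e01[unfolded One_nat_def] e10[of k] by cases simp_all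
      qed
      then show ?thesis unfolding n3_minus_sum_coord[OF n ijk] using 1 by simp
    next
      case 2
      then show ?thesis unfolding n3_minus_sum_coord[OF n ijk] by auto
    qed
  qed
qed

section \<open>Every product lies in the span of its factors\<close>

text \<open>If every product lies in the span of its factors, then comparing \<open>e\<^sub>0(e\<^sub>i + e\<^sub>j)\<close> with
  \<open>e\<^sub>0e\<^sub>i + e\<^sub>0e\<^sub>j\<close> shows that \<open>e\<^sub>0\<close> acts on each side by a scalar modulo \<open>e\<^sub>0\<close>.\<close>

lemma span_closed_coords:
  assumes n: "2 \<le> n" and l: "l \<in> algs n"
    and span: "\<And>u v. u \<in> carrier_vec n \<Longrightarrow> v \<in> carrier_vec n \<Longrightarrow> \<exists>a b. l u v = a \<cdot>\<^sub>v u + b \<cdot>\<^sub>v v"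
  shows "\<exists>a b.
    (\<forall>i k. 0 < i \<longrightarrow> 0 < k \<longrightarrow> i < n \<longrightarrow> k < n \<longrightarrow>
      l (unit_vec n 0) (unit_vec n i) $ k = (if i = k then a else 0) \<and>
      l (unit_vec n i) (unit_vec n 0) $ k = (if i = k then b else 0)) \<and>
    l (unit_vec n 0) (unit_vec n 0) = (a + b) \<cdot>\<^sub>v unit_vec n 0"
proof -
  let ?e = "unit_vec n :: nat \<Rightarrow> complex vec"
  \<comment> \<open>Stated for a general linear \<open>f\<close> so as to serve left and right
    multiplication by \<open>e_0\<close> alike.\<close>
  have scalar: "\<exists>a. \<forall>i k. 0 < i \<longrightarrow> 0 < k \<longrightarrow> i < n \<longrightarrow> k < n \<longrightarrow> f (?e i) $ k = (if i = k then a else 0)"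
    if car: "\<And>v. v \<in> carrier_vec n \<Longrightarrow> f v \<in> carrier_vec n"
      and add: "\<And>u v. u \<in> carrier_vec n \<Longrightarrow> v \<in> carrier_vec n \<Longrightarrow> f (u + v) = f u + f v"
      and sp: "\<And>v. v \<in> carrier_vec n \<Longrightarrow> \<exists>a b. f v = a \<cdot>\<^sub>v ?e 0 + b \<cdot>\<^sub>v v"
    for f :: "complex vec \<Rightarrow> complex vec"
  proof (intro exI allI impI)
    fix i k assume ik: "0 < i" "0 < k" "i < n" "k < n"
    have off: "f (?e i) $ k = 0" if "i \<noteq> k" "0 < k" "i < n" "k < n" for i k
      using sp[of "?e i"] that by auto
    have "f (?e i) $ i = f (?e 1) $ 1" if i: "i \<noteq> 1"
    proof -
      obtain r s where rs: "f (?e i + ?e 1) = r \<cdot>\<^sub>v ?e 0 + s \<cdot>\<^sub>v (?e i + ?e 1)"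
        using sp[of "?e i + ?e 1"] by auto
      \<comment> \<open>Entries \<open>i\<close> and \<open>1\<close> of
        \<open>f (e_i + e_1)\<close> both equal \<open>s\<close>; the off-diagonal terms vanish by
        \<open>off\<close>.\<close>
      have "f (?e i) $ k + f (?e 1) $ k = s" if "k = i \<or> k = 1" for k
        using arg_cong[OF rs, of "\<lambda>v. v $ k"] car[of "?e i"] car[of "?e 1"] that ik n i
        by (auto simp: add)
      from this[of i] this[of 1] show ?thesis
        using off[of 1 i] off[of i 1] ik n i by simp
    qed
    then show "f (?e i) $ k = (if i = k then f (?e 1) $ 1 else 0)"
      using off[of i k] ik by auto
  qed
  have carr: "l (?e i) (?e j) \<in> carrier_vec n" for i j by (simp add: algsD(1)[OF l])
  obtain a where a: "\<And>i k. \<lbrakk>0 < i; 0 < k; i < n; k < n\<rbrakk> \<Longrightarrow> l (?e 0) (?e i) $ k = (if i = k then a else 0)"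
    using scalar[of "\<lambda>v. l (?e 0) v"] algsD[OF l] span by auto
  have "\<exists>a b. l v (?e 0) = a \<cdot>\<^sub>v ?e 0 + b \<cdot>\<^sub>v v" if v: "v \<in> carrier_vec n" for v
  proof -
    obtain a b where "l v (?e 0) = a \<cdot>\<^sub>v v + b \<cdot>\<^sub>v ?e 0"
      using span[OF v unit_vec_carrier[of n 0]] by blast
    then have "l v (?e 0) = b \<cdot>\<^sub>v ?e 0 + a \<cdot>\<^sub>v v"
      using v by (simp add: comm_add_vec[of "a \<cdot>\<^sub>v v" n "b \<cdot>\<^sub>v ?e 0"])
    then show ?thesis by blast
  qed
  then obtain b where b: "\<And>i k. \<lbrakk>0 < i; 0 < k; i < n; k < n\<rbrakk> \<Longrightarrow> l (?e i) (?e 0) $ k = (if i = k then b else 0)"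
    using scalar[of "\<lambda>v. l v (?e 0)"] algsD[OF l] by auto
  obtain f where f: "l (?e 0) (?e 0) = f \<cdot>\<^sub>v ?e 0"
    using span[of "?e 0" "?e 0"] by (auto simp: add_smult_distrib_vec[symmetric])
  have f1: "l (?e 1) (?e 1) $ 0 = 0"
    using span[of "?e 1" "?e 1"] n by auto
  \<comment> \<open>The square of \<open>u = e_0 + t e_1\<close> is a multiple of \<open>u\<close>,
    so its entry 1 is \<open>t\<close> times its entry 0. Expanding, with \<open>f1\<close> removing
    the term in \<open>t^2\<close> from entry 0, and cancelling \<open>t\<close> gives the
    relation.\<close>
  have rel: "f + t * (l (?e 0) (?e 1) $ 0 + l (?e 1) (?e 0) $ 0) = t * l (?e 1) (?e 1) $ 1 + (a + b)"
    if t: "t \<noteq> 0" for t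
  proof -
    let ?u = "?e 0 + t \<cdot>\<^sub>v ?e 1"
    obtain r s where "l ?u ?u = r \<cdot>\<^sub>v ?u + s \<cdot>\<^sub>v ?u" using span[of ?u ?u] by auto
    then have g: "l ?u ?u $ 1 = t * l ?u ?u $ 0" using n by (simp add: algebra_simps)
    have k: "l ?u ?u $ k = l (?e 0) (?e 0) $ k + t * l (?e 1) (?e 0) $ k
        + (t * l (?e 0) (?e 1) $ k + t * (t * l (?e 1) (?e 1) $ k))" if "k < n" for k
      using that carr[of 0 0] carr[of 0 1] carr[of 1 0] carr[of 1 1]
      by (simp add: algsD(2-)[OF l] distrib_left)
    have "l (?e 0) (?e 0) $ 0 = f" "l (?e 0) (?e 0) $ 1 = 0" "l (?e 0) (?e 1) $ 1 = a" "l (?e 1) (?e 0) $ 1 = b"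
      using f a[of 1 1] b[of 1 1] n by simp_all
    then have "t * (f + t * (l (?e 0) (?e 1) $ 0 + l (?e 1) (?e 0) $ 0)) = t * (t * l (?e 1) (?e 1) $ 1 + (a + b))"
      using g k[of 0] k[of 1] n f1 by (simp add: distrib_left add_ac)
    then show ?thesis using t by auto
  qed
  \<comment> \<open>Adding the relations for \<open>t = 1\<close> and \<open>t = -1\<close> cancels
    the terms odd in \<open>t\<close>.\<close>
  have "(f + (l (?e 0) (?e 1) $ 0 + l (?e 1) (?e 0) $ 0)) + (f - (l (?e 0) (?e 1) $ 0 + l (?e 1) (?e 0) $ 0))
      = (l (?e 1) (?e 1) $ 1 + (a + b)) + (a + b - l (?e 1) (?e 1) $ 1)"
    using rel[of 1] rel[of "- 1"] by simp
  then have "2 * f = 2 * (a + b)" by simp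
  then have "f = a + b" by (simp only: mult_cancel_left) simp
  then show ?thesis using a b f by (intro exI[of _ a] exI[of _ b]) simp
qed

text \<open>A nonzero square rescales to an idempotent, which leads to \<open>nu\<close>. If all
  squares vanish, the product is alternating, and a nonzero product supplies a vector leading to
  \<open>p_minus\<close>.\<close>

lemma degenerates_span_closed:
  assumes n: "2 \<le> n" and l: "l \<in> algs n" and nab: "\<not> abelian n l"
    and span: "\<And>u v. u \<in> carrier_vec n \<Longrightarrow> v \<in> carrier_vec n \<Longrightarrow> \<exists>a b. l u v = a \<cdot>\<^sub>v u + b \<cdot>\<^sub>v v"
  shows "degenerates n l (p_minus n) \<or> (\<exists>\<alpha>. degenerates n l (nu n \<alpha>))"
proof -
  let ?e = "unit_vec n :: nat \<Rightarrow> complex vec"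
  \<comment> \<open>With \<open>x\<close> as \<open>e_0\<close> and \<open>y\<close> as
    \<open>e_1\<close>, the first alternative of \<open>cases\<close> gives
    \<open>a + b = 1\<close>, the second \<open>a = 1\<close> and \<open>b = -1\<close>.\<close>
  have pass: ?thesis
    if x: "x \<in> carrier_vec n" and y: "y \<in> carrier_vec n" and x0: "x \<noteq> 0\<^sub>v n" and indep: "\<And>c. y \<noteq> c \<cdot>\<^sub>v x"
      and cases: "l x x = x \<or> l x x = 0\<^sub>v n \<and> (\<exists>r. l x y = r \<cdot>\<^sub>v x + y)" for x y
  proof -
    have carrier: "\<forall>j<2. [x, y] ! j \<in> carrier_vec n"
      using x y by (auto simp: less_2_cases_iff)
    obtain P l' where P: "P \<in> GL n" and l': "l' \<in> algs n"
      and frame: "\<forall>j<2. P *\<^sub>v ?e j = [x, y] ! j"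
        "\<forall>x\<in>carrier_vec n. \<forall>y\<in>carrier_vec n. l' x y = GL_inv n P *\<^sub>v l (P *\<^sub>v x) (P *\<^sub>v y)"
        "\<forall>m. degenerates n l' m \<longrightarrow> degenerates n l m"
      using change_of_frame[OF l n carrier pair_frame[OF x x0 indep]]
      by (elim bexE conjE) (rule that)
    note Pj = frame(1)[rule_format] and l'_eq = frame(2)[rule_format] and deg = frame(3)[rule_format]
    note Pc = GL_carrier[OF P]
    have lin: "GL_inv n P *\<^sub>v (a \<cdot>\<^sub>v (P *\<^sub>v u) + b \<cdot>\<^sub>v (P *\<^sub>v v)) = a \<cdot>\<^sub>v u + b \<cdot>\<^sub>v v"
      if "u \<in> carrier_vec n" "v \<in> carrier_vec n" for a b u v
      using that Pc by (simp add: mult_add_distrib_mat_vec[OF Pc(2)] mult_mat_vec[OF Pc(2)]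
          GL_inv_cancel(1)[OF P])
    have span': "\<exists>a b. l' u v = a \<cdot>\<^sub>v u + b \<cdot>\<^sub>v v" if uv: "u \<in> carrier_vec n" "v \<in> carrier_vec n" for u v
    proof -
      obtain a b where "l (P *\<^sub>v u) (P *\<^sub>v v) = a \<cdot>\<^sub>v (P *\<^sub>v u) + b \<cdot>\<^sub>v (P *\<^sub>v v)"
        using span[of "P *\<^sub>v u" "P *\<^sub>v v"] Pc uv by auto
      then have "l' u v = a \<cdot>\<^sub>v u + b \<cdot>\<^sub>v v" using uv by (simp add: l'_eq lin)
      then show ?thesis by blast
    qed
    obtain a b
      where a: "\<And>i k. \<lbrakk>0 < i; 0 < k; i < n; k < n\<rbrakk> \<Longrightarrow> l' (?e 0) (?e i) $ k = (if i = k then a else 0)"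
        and b: "\<And>i k. \<lbrakk>0 < i; 0 < k; i < n; k < n\<rbrakk> \<Longrightarrow> l' (?e i) (?e 0) $ k = (if i = k then b else 0)"
        and ab: "l' (?e 0) (?e 0) = (a + b) \<cdot>\<^sub>v ?e 0"
      using span_closed_coords[OF n l' span'] by blast
    \<comment> \<open>The only negative weights belong to the entries of \<open>e_0 e_0\<close> at
      \<open>k > 0\<close>, which vanish by \<open>ab\<close>. Weight 0 leaves exactly
      \<open>e_0 e_0\<close> along \<open>e_0\<close> and the scalars \<open>a\<close>,
      \<open>b\<close>.\<close>
    let ?a = "\<lambda>i. if i = 0 then 0 else 1 :: nat"
    from cases show ?thesis
    proof (elim disjE conjE exE)
      assume "l x x = x"
      then have "l' (?e 0) (?e 0) = ?e 0"
        using Pj[of 0] GL_inv_cancel(1)[OF P, of "?e 0"] by (simp add: l'_eq)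
      with ab have "a + b = 1" using n by (auto dest: arg_cong[where f = "\<lambda>v. v $ 0"])
      then have "b = 1 - a" by (simp add: algebra_simps)
      have "degenerates n l' (nu n a)"
      proof (rule degenerates_weights[OF l' target_in_algs(2), where a = ?a])
        fix i j k assume "i < n" "j < n" "k < n"
        then show "?a i + ?a j = ?a k \<and> nu n a (?e i) (?e j) $ k = l' (?e i) (?e j) $ k \<or>
          ?a k < ?a i + ?a j \<and> nu n a (?e i) (?e j) $ k = 0 \<or>
          l' (?e i) (?e j) $ k = 0 \<and> nu n a (?e i) (?e j) $ k = 0"
          using a[of j k] b[of i k] ab \<open>b = 1 - a\<close> by (auto simp: nu_coord)
      qed
      then show ?thesis using deg by blast
    next
      fix r assume xx: "l x x = 0\<^sub>v n" and xy: "l x y = r \<cdot>\<^sub>v x + y"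
      have zero_comb: "0 \<cdot>\<^sub>v u + 0 \<cdot>\<^sub>v u = 0\<^sub>v n" if "u \<in> carrier_vec n" for u :: "complex vec"
        using that by (intro eq_vecI) auto
      have "l' (?e 0) (?e 0) = 0\<^sub>v n"
        using lin[of "?e 0" "?e 0" 0 0] Pj[of 0] xx zero_comb[OF x] zero_comb[of "?e 0"] by (simp add: l'_eq)
      with ab have ab0: "a + b = 0" using n by (auto dest: arg_cong[where f = "\<lambda>v. v $ 0"])
      have "l' (?e 0) (?e 1) = r \<cdot>\<^sub>v ?e 0 + ?e 1"
        using Pj[of 0] Pj[of 1] xy lin[of "?e 0" "?e 1" r 1] by (simp add: l'_eq)
      then have "a = 1" using a[of 1 1] n by simp
      with ab0 have "b = - 1" by (simp add: add_eq_0_iff)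
      have "degenerates n l' (p_minus n)"
      proof (rule degenerates_weights[OF l' target_in_algs(1), where a = ?a])
        fix i j k assume "i < n" "j < n" "k < n"
        then show "?a i + ?a j = ?a k \<and> p_minus n (?e i) (?e j) $ k = l' (?e i) (?e j) $ k \<or>
          ?a k < ?a i + ?a j \<and> p_minus n (?e i) (?e j) $ k = 0 \<or>
          l' (?e i) (?e j) $ k = 0 \<and> p_minus n (?e i) (?e j) $ k = 0"
          using a[of j k] b[of i k] ab \<open>a = 1\<close> \<open>b = - 1\<close> by (auto simp: p_minus_coord)
      qed
      then show ?thesis using deg by blast
    qed
  qed
  note zero = algs_zero[OF l]
  have sq: "\<exists>c. l x x = c \<cdot>\<^sub>v x" if "x \<in> carrier_vec n" for x
    using span[OF that that] by (auto simp: add_smult_distrib_vec[symmetric])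
  show ?thesis
  proof (cases "\<exists>x\<in>carrier_vec n. l x x \<noteq> 0\<^sub>v n")
    case True
    then obtain x c where x: "x \<in> carrier_vec n" and xx: "l x x \<noteq> 0\<^sub>v n" and c: "l x x = c \<cdot>\<^sub>v x"
      using sq by blast
    have c0: "c \<noteq> 0" using xx c x by auto
    \<comment> \<open>Since \<open>x x = c x\<close>, rescaling by \<open>inverse c\<close> makes
      \<open>x\<close> idempotent.\<close>
    define z where "z = inverse c \<cdot>\<^sub>v x"
    have z: "z \<in> carrier_vec n" "l z z = z"
      using x c0 by (auto simp: z_def algsD[OF l] c smult_smult_assoc)
    have z0: "z \<noteq> 0\<^sub>v n"
    proof
      assume "z = 0\<^sub>v n"
      moreover have "x = c \<cdot>\<^sub>v z" using c0 by (simp add: z_def smult_smult_assoc)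
      ultimately have "x = 0\<^sub>v n" by (intro eq_vecI) auto
      then show False using xx zero(1)[OF x] by simp
    qed
    have "\<exists>y\<in>carrier_vec n. \<forall>c. y \<noteq> c \<cdot>\<^sub>v z"
    proof (rule ccontr)
      assume "\<not> ?thesis"
      \<comment> \<open>\<open>e_0\<close> and \<open>e_1\<close> cannot both be multiples of
        \<open>z\<close>.\<close>
      then obtain c d where "?e 0 = c \<cdot>\<^sub>v z" "?e 1 = d \<cdot>\<^sub>v z" by (meson unit_vec_carrier)
      then have "c * z $ 0 = 1" "c * z $ 1 = 0" "d * z $ 1 = 1"
        using n z(1) by (auto dest!: arg_cong[where f = "\<lambda>v. (v $ 0, v $ 1)"])
      then show False by auto
    qed
    then show ?thesis using pass[OF z(1) _ z0] z(2) by blast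
  next
    case False
    then have sq0: "l x x = 0\<^sub>v n" if "x \<in> carrier_vec n" for x using that by blast
    \<comment> \<open>\<open>x / s\<close> multiplies \<open>y\<close> to \<open>y\<close> modulo
      \<open>x\<close>. If \<open>y\<close> were a multiple of \<open>x\<close>, then
      \<open>x y\<close> would be a multiple of \<open>x x = 0\<close>.\<close>
    have *: ?thesis if x: "x \<in> carrier_vec n" and y: "y \<in> carrier_vec n" and xy: "l x y = r \<cdot>\<^sub>v x + s \<cdot>\<^sub>v y"
      and nz: "l x y \<noteq> 0\<^sub>v n" and s: "s \<noteq> 0" for x y r s
    proof (rule pass[of "inverse s \<cdot>\<^sub>v x" y])
      show "inverse s \<cdot>\<^sub>v x \<noteq> 0\<^sub>v n"
      proof
        assume "inverse s \<cdot>\<^sub>v x = 0\<^sub>v n"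
        moreover have "x = s \<cdot>\<^sub>v (inverse s \<cdot>\<^sub>v x)" using s by (simp add: smult_smult_assoc)
        ultimately have "x = s \<cdot>\<^sub>v 0\<^sub>v n" by simp
        then have "x = 0\<^sub>v n" by (intro eq_vecI) auto
        then show False using nz zero(1)[OF y] by simp
      qed
      show "y \<noteq> c \<cdot>\<^sub>v (inverse s \<cdot>\<^sub>v x)" for c
        using nz sq0[OF x] x by (auto simp: algsD(5)[OF l])
      have "l (inverse s \<cdot>\<^sub>v x) y = r \<cdot>\<^sub>v (inverse s \<cdot>\<^sub>v x) + y"
        using x y s by (simp add: algsD(4)[OF l] xy smult_add_distrib_vec[of _ n] smult_smult_assoc mult.commute)
      then show "l (inverse s \<cdot>\<^sub>v x) (inverse s \<cdot>\<^sub>v x) = inverse s \<cdot>\<^sub>v x \<or>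
          l (inverse s \<cdot>\<^sub>v x) (inverse s \<cdot>\<^sub>v x) = 0\<^sub>v n \<and> (\<exists>r. l (inverse s \<cdot>\<^sub>v x) y = r \<cdot>\<^sub>v (inverse s \<cdot>\<^sub>v x) + y)"
        using sq0[of "inverse s \<cdot>\<^sub>v x"] x by auto
    qed (use x y in auto)
    obtain x y where x: "x \<in> carrier_vec n" and y: "y \<in> carrier_vec n" and nz: "l x y \<noteq> 0\<^sub>v n"
      using nab by (auto simp: abelian_def)
    obtain r s where xy: "l x y = r \<cdot>\<^sub>v x + s \<cdot>\<^sub>v y" using span[OF x y] by blast
    show ?thesis
    proof (cases "s = 0")
      \<comment> \<open>Swap the factors: squares vanish, so \<open>y x = - x y = - r x\<close>,
        whose coefficient at the second factor \<open>x\<close> is nonzero.\<close>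
      case True
      have car: "l x y \<in> carrier_vec n" "l y x \<in> carrier_vec n" using algsD(1)[OF l] x y by auto
      have "0\<^sub>v n = l x (x + y) + l y (x + y)"
        using algsD(2)[OF l x y, of "x + y"] sq0[of "x + y"] x y by simp
      also have "\<dots> = (l x x + l x y) + (l y x + l y y)"
        using algsD(3)[OF l x y] x y by simp
      also have "\<dots> = l x y + l y x"
        using car by (simp add: sq0 x y)
      finally have sum0: "l x y + l y x = 0\<^sub>v n" by simp
      have anti: "l y x $ k = - (l x y $ k)" if "k < n" for k
        using arg_cong[OF sum0, of "\<lambda>v. v $ k"] car that
        by (simp add: eq_neg_iff_add_eq_0 add.commute)
      have "l y x = 0 \<cdot>\<^sub>v y + (- r) \<cdot>\<^sub>v x"
        using x y car anti xy True by (intro eq_vecI) auto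
      moreover have "r \<noteq> 0" using nz xy True x y by auto
      moreover have "l y x \<noteq> 0\<^sub>v n"
      proof
        assume "l y x = 0\<^sub>v n"
        then have "l x y = 0\<^sub>v n" using car anti by (intro eq_vecI) auto
        then show False using nz by simp
      qed
      ultimately show ?thesis using *[OF y x] by simp
    qed (use *[OF x y xy nz] in simp)
  qed
qed

section \<open>Combining the three cases\<close>

theorem proposition2p2:
  fixes n :: nat and l :: mult
  assumes "n \<ge> 3" and "l \<in> algs n" and "\<not> abelian n l"
  shows "degenerates n l (p_minus n)
    \<or> degenerates n l (alg_sum 3 (n - 3) n3_minus (zero_alg (n - 3)))
    \<or> degenerates n l (alg_sum 2 (n - 2) lambda2 (zero_alg (n - 2)))
    \<or> (\<exists>\<alpha>. degenerates n l (nu n \<alpha>))"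
proof (cases "\<exists>x\<in>carrier_vec n. \<forall>c. l x x \<noteq> c \<cdot>\<^sub>v x")
  case True
  then show ?thesis using degenerates_lambda2[OF _ assms(2)] assms(1) by auto
next
  case False
  then have sq: "\<exists>c. l x x = c \<cdot>\<^sub>v x" if "x \<in> carrier_vec n" for x using that by blast
  show ?thesis
  proof (cases "\<exists>x\<in>carrier_vec n. \<exists>y\<in>carrier_vec n. \<forall>a b. l x y \<noteq> a \<cdot>\<^sub>v x + b \<cdot>\<^sub>v y")
    case True
    then show ?thesis using degenerates_n3_minus[OF assms(1,2) _ _ sq] by blast
  next
    case False
    then show ?thesis using degenerates_span_closed[OF _ assms(2,3)] assms(1) by auto
  qed
qed

end
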